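(* Let $H=(h_{ik})$ be the adjacency matrix of a graph on $m$ vertices, $B\in\mathcal{M}^+$, $V\in\mathcal{M}$, and let $X_H(t)=(x_{ij}(t))$ be the $X$-component of the solution of $X'=Y$, $Y'=F_H(X)$, $X(t_0)=B$, $Y(t_0)=V$, which is defined for all $t\in\mathbb{R}$. For $t_1\in\mathbb{R}$ let $\{a_{ijn}(t_1)\}_{n\geq 0}$ with $a_{ijn}(t_1)=x_{ij}^{(n)}(t_1)/n!$ be the coefficients of the Taylor series of $x_{ij}$ at $t_1$. Then for all $t_1\in\mathbb{R}$ and all indices $i,j,r,s$, the power series $\{a_{ijn}(t_1)\}$ and $\{a_{rsn}(t_1)\}$ are equal if and only if the functions $x_{ij}(t)$ and $x_{rs}(t)$ are equal on $\mathbb{R}$.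
   Context: $\mathcal{M}$ is the set of real $m\times m$ matrices and $\mathcal{M}^+\subset\mathcal{M}$ the set of those with pairwise distinct rows. For $X\in\mathcal{M}^+$ with rows $x_1,\dots,x_m$ (Euclidean norm $\|\cdot\|$), $F_H(X)_{ij}=\sum_{k\neq i}(x_{ij}-x_{kj})\left(\frac{1}{\|x_i-x_k\|^2}-h_{ik}\right)$. *)

theory Defs
  imports "HOL-Analysis.Analysis"
begin

text \<open>Graphs are finite, simple and undirected; the vertex set is the whole index type \<open>'m\<close>,
  and edges are two-element sets of vertices (in particular there are no loops).\<close>

definition simple_graph :: "'m::finite set set \<Rightarrow> bool" where
  "simple_graph E \<longleftrightarrow> (\<forall>e\<in>E. card e = 2)"

definition adjacency_matrix :: "'m::finite set set \<Rightarrow> real^'m^'m" where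
  "adjacency_matrix E = (\<chi> i k. if {i, k} \<in> E then 1 else 0)"

definition distinct_rows :: "(real^'m^'m) set" where
  "distinct_rows = {X. \<forall>i k. i \<noteq> k \<longrightarrow> row i X \<noteq> row k X}"

definition force :: "real^'m^'m \<Rightarrow> real^'m^'m \<Rightarrow> real^'m^'m" where
  "force H X = (\<chi> i j. \<Sum>k\<in>UNIV - {i}.
      (X $ i $ j - X $ k $ j) * (1 / (norm (row i X - row k X))\<^sup>2 - H $ i $ k))"

text \<open>Since \<open>1 / 0 = 0\<close>, \<^const>\<open>force\<close> is total; a solution is required to stay in
  \<^const>\<open>distinct_rows\<close>, the actual domain of the right-hand side.\<close>

definition global_solution ::
  "real^'m^'m \<Rightarrow> real \<Rightarrow> real^'m^'m \<Rightarrow> real^'m^'m \<Rightarrow>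
   (real \<Rightarrow> real^'m^'m) \<Rightarrow> (real \<Rightarrow> real^'m^'m) \<Rightarrow> bool" where
  "global_solution H t0 B V X Y \<longleftrightarrow>
     (\<forall>t. X t \<in> distinct_rows) \<and>
     (\<forall>t. (X has_vector_derivative Y t) (at t)) \<and>
     (\<forall>t. (Y has_vector_derivative force H (X t)) (at t)) \<and>
     X t0 = B \<and> Y t0 = V"

definition taylor_coeff ::
  "(real \<Rightarrow> real^'m^'m) \<Rightarrow> 'm \<Rightarrow> 'm \<Rightarrow> real \<Rightarrow> nat \<Rightarrow> real" where
  "taylor_coeff X i j t n = (deriv ^^ n) (\<lambda>u. X u $ i $ j) t / fact n"

end

theory Submission imports Defs begin

text \<open>Adjoining the functions \<open>u\<^sub>i\<^sub>k = 1 / \<parallel>x\<^sub>i - x\<^sub>k\<parallel>\<^sup>2\<close> turns the system into an autonomous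
  polynomial one. Along a solution of such a system the derivative of a polynomial of degree
  \<open>\<le> d\<close> with coefficient sum \<open>\<le> N\<close> is a polynomial of degree \<open>\<le> d + p\<close> with coefficient sum
  \<open>\<le> N d K\<close>, where \<open>p\<close> and \<open>K\<close> depend only on the system. Iterating, the \<open>n\<close>-th derivative is
  locally bounded by \<open>A C\<^sup>n n!\<close>, so by Taylor's theorem solutions are locally given by their Taylor
  series, and the points where all derivatives vanish form a closed and open set.\<close>

section \<open>Functions whose derivatives grow at most factorially\<close>

text \<open>All Taylor terms at \<open>t1\<close> vanish, so for every order \<open>n\<close> the
  value at \<open>t\<close> is just the Lagrange remainder. That is at most
  \<open>A * (C * |t - t1|) ^ n\<close>, which tends to 0.\<close>

lemma factorial_bounds_imp_eq_0_near:
  fixes D :: "nat \<Rightarrow> real \<Rightarrow> real"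
  assumes deriv: "\<And>n t. (D n has_real_derivative D (Suc n) t) (at t)"
    and bound: "\<And>n s. \<bar>s - t1\<bar> < e \<Longrightarrow> \<bar>D n s\<bar> \<le> A * C ^ n * fact n"
    and zero: "\<And>n. D n t1 = 0"
    and t: "\<bar>t - t1\<bar> < e" "C * \<bar>t - t1\<bar> < 1" and "0 \<le> C"
  shows "D 0 t = 0"
proof -
  define x where "x = t - t1"
  have le: "\<bar>D 0 t\<bar> \<le> A * (C * \<bar>x\<bar>) ^ n" for n
  proof -
    have "\<exists>s. \<bar>s\<bar> \<le> \<bar>x\<bar> \<and> D 0 (t1 + x) =
        (\<Sum>m<n. D m (t1 + 0) / fact m * x ^ m) + D n (t1 + s) / fact n * x ^ n"
    proof (rule Maclaurin_all_le)
      have "((\<lambda>s. D m (s + t1)) has_real_derivative D (Suc m) (u + t1)) (at u)" for m u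
        by (rule DERIV_shift[THEN iffD1]) (rule deriv)
      then show "\<forall>m u. ((\<lambda>s. D m (t1 + s)) has_real_derivative D (Suc m) (t1 + u)) (at u)"
        by (simp add: add.commute)
    qed simp
    then obtain s where s: "\<bar>s\<bar> \<le> \<bar>x\<bar>" "D 0 t = D n (t1 + s) / fact n * x ^ n"
      using zero by (auto simp: x_def)
    have "\<bar>D n (t1 + s)\<bar> \<le> A * C ^ n * fact n"
      using s(1) t(1) by (intro bound) (simp add: x_def)
    then have "\<bar>D n (t1 + s)\<bar> / fact n \<le> A * C ^ n"
      by (simp add: divide_le_eq)
    then have "\<bar>D n (t1 + s)\<bar> / fact n * \<bar>x\<bar> ^ n \<le> A * C ^ n * \<bar>x\<bar> ^ n"
      by (rule mult_right_mono) simp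
    then show ?thesis
      by (simp add: s(2) abs_mult power_abs power_mult_distrib mult.assoc)
  qed
  have "(\<lambda>n. A * (C * \<bar>x\<bar>) ^ n) \<longlonglongrightarrow> A * 0"
    using t(2) \<open>0 \<le> C\<close> by (intro tendsto_mult_left LIMSEQ_realpow_zero) (auto simp: x_def)
  then have "\<bar>D 0 t\<bar> \<le> A * 0"
    by (rule LIMSEQ_le_const) (use le in blast)
  then show ?thesis by simp
qed

text \<open>The common zero set \<open>S\<close> of all \<open>D n\<close> is closed by continuity,
  open by the local lemma and contains \<open>t1\<close>, so connectedness of the line gives
  \<open>S = UNIV\<close>. The constants may depend on the centre \<open>c\<close>.\<close>

lemma factorial_bounds_imp_eq_0:
  fixes D :: "nat \<Rightarrow> real \<Rightarrow> real"
  assumes deriv: "\<And>n t. (D n has_real_derivative D (Suc n) t) (at t)"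
    and bound: "\<And>c. \<exists>A C. 0 \<le> C \<and> (\<forall>n s. \<bar>s - c\<bar> < 1 \<longrightarrow> \<bar>D n s\<bar> \<le> A * C ^ n * fact n)"
    and zero: "\<And>n. D n t1 = 0"
  shows "D 0 t = 0"
proof -
  define S where "S = (\<Inter>n. {s. D n s = 0})"
  have cont: "continuous_on UNIV (D n)" for n
    using deriv by (meson DERIV_isCont continuous_at_imp_continuous_on)
  have "closed S"
    unfolding S_def by (intro closed_INT ballI closed_Collect_eq cont continuous_on_const)
  moreover have "open S"
    unfolding open_dist
  proof
    fix c assume "c \<in> S"
    then have c: "D n c = 0" for n by (simp add: S_def)
    obtain A C where C: "0 \<le> C"
      and AC: "\<And>n s. \<bar>s - c\<bar> < 1 \<Longrightarrow> \<bar>D n s\<bar> \<le> A * C ^ n * fact n"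
      using bound by blast
    \<comment> \<open>This radius stays within the unit interval on which the bounds hold and keeps
      \<open>C * e < 1\<close>; the \<open>+ 1\<close> also covers \<open>C = 0\<close>.\<close>
    define e where "e = 1 / (C + 1)"
    have e: "0 < e" "e \<le> 1" "C * e < 1"
      using C by (auto simp: e_def field_simps)
    \<comment> \<open>The local lemma only handles \<open>D 0\<close>. The rest follows by
      induction: if \<open>D n\<close> vanishes on the open ball, so does its derivative
      \<open>D (Suc n)\<close>.\<close>
    have vanish: "D n s = 0" if s: "dist s c < e" for n s
      using s
    proof (induction n arbitrary: s)
      case 0
      then have "\<bar>s - c\<bar> < e" by (simp add: dist_real_def)
      moreover from this have "C * \<bar>s - c\<bar> \<le> C * e"
        using C by (intro mult_left_mono) auto
      ultimately show ?case
        using e C by (intro factorial_bounds_imp_eq_0_near[of D c 1 A C]) (auto intro: deriv AC c)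
    next
      case (Suc n)
      have "(D n has_real_derivative 0) (at s)"
      proof (rule has_field_derivative_transform_within_open)
        show "((\<lambda>_. 0) has_real_derivative 0) (at s)" by simp
        show "s \<in> ball c e" using Suc.prems by (simp add: dist_commute)
        show "0 = D n u" if "u \<in> ball c e" for u
          using Suc.IH[of u] that by (simp add: dist_commute)
      qed simp
      with deriv show ?case by (rule DERIV_unique)
    qed
    show "\<exists>e>0. \<forall>s. dist s c < e \<longrightarrow> s \<in> S"
      using e(1) vanish by (auto simp: S_def)
  qed
  moreover have "t1 \<in> S"
    using zero by (simp add: S_def)
  ultimately have "S = UNIV"
    using clopen by blast
  then show ?thesis
    by (auto simp: S_def)
qed

section \<open>Polynomials with control of degree and coefficient sum\<close>

text \<open>\<open>poly_bd Z d N f\<close>: the function \<open>f\<close> is a polynomial in elements of \<open>Z\<close> of total degree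
  at most \<open>d\<close> whose coefficients have absolute values summing up to at most \<open>N\<close>.\<close>

inductive poly_bd :: "(real \<Rightarrow> real) set \<Rightarrow> nat \<Rightarrow> real \<Rightarrow> (real \<Rightarrow> real) \<Rightarrow> bool" for Z where
  gen: "z \<in> Z \<Longrightarrow> poly_bd Z 1 1 z"
| const: "poly_bd Z 0 \<bar>c\<bar> (\<lambda>_. c)"
| add: "poly_bd Z d N f \<Longrightarrow> poly_bd Z d N' g \<Longrightarrow> poly_bd Z d (N + N') (\<lambda>t. f t + g t)"
| mult: "poly_bd Z d N f \<Longrightarrow> poly_bd Z e N' g \<Longrightarrow> poly_bd Z (d + e) (N * N') (\<lambda>t. f t * g t)"
| weaken: "poly_bd Z d N f \<Longrightarrow> d \<le> e \<Longrightarrow> N \<le> N' \<Longrightarrow> poly_bd Z e N' f"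

lemma poly_bd_nonneg: "poly_bd Z d N f \<Longrightarrow> 0 \<le> N"
  by (induction rule: poly_bd.induct) auto

text \<open>The hypothesis \<open>1 <= M\<close> makes \<open>M ^ d\<close> dominate the monomials
  of degree below \<open>d\<close> as well.\<close>

lemma poly_bd_abs_le:
  assumes "poly_bd Z d N f" and M: "1 \<le> M" "\<And>z. z \<in> Z \<Longrightarrow> \<bar>z t\<bar> \<le> M"
  shows "\<bar>f t\<bar> \<le> N * M ^ d"
  using assms(1)
proof (induction rule: poly_bd.induct)
  case (add d N f N' g)
  then show ?case by (simp add: algebra_simps)
next
  case (mult d N f e N' g)
  have "\<bar>f t\<bar> * \<bar>g t\<bar> \<le> (N * M ^ d) * (N' * M ^ e)"
    using mult M poly_bd_nonneg by (intro mult_mono) auto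
  then show ?case by (simp add: abs_mult power_add mult_ac)
next
  case (weaken d N f e N')
  have "N * M ^ d \<le> N' * M ^ e"
    using weaken M poly_bd_nonneg[OF weaken.hyps(1)]
    by (intro mult_mono power_increasing) auto
  with weaken show ?case by simp
qed (use M in auto)

text \<open>By the product rule a monomial of degree at most \<open>d\<close> yields at most
  \<open>d\<close> terms. Each replaces one generator by a polynomial of degree \<open>Suc p\<close>
  and coefficient sum \<open>K\<close>, so the degree bound grows by \<open>p\<close> and the
  coefficient bound by the factor \<open>d * K\<close>.\<close>

lemma poly_bd_has_derivative:
  assumes "poly_bd Z d N f" and K: "0 \<le> K"
    and Z: "\<forall>z\<in>Z. \<exists>z'. (\<forall>t. (z has_real_derivative z' t) (at t)) \<and> poly_bd Z (Suc p) K z'"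
  shows "\<exists>f'. (\<forall>t. (f has_real_derivative f' t) (at t)) \<and> poly_bd Z (d + p) (N * d * K) f'"
  using assms(1)
proof (induction rule: poly_bd.induct)
  case (gen z)
  with Z show ?case by simp
next
  case (const c)
  have "poly_bd Z p 0 (\<lambda>_. 0)"
    using poly_bd.weaken[OF poly_bd.const[of Z 0]] by simp
  then show ?case by (intro exI[of _ "\<lambda>_. 0"]) simp
next
  case (add d N f N' g)
  then obtain f' g' where
    "\<forall>t. (f has_real_derivative f' t) (at t)" "poly_bd Z (d + p) (N * d * K) f'"
    "\<forall>t. (g has_real_derivative g' t) (at t)" "poly_bd Z (d + p) (N' * d * K) g'" by blast
  then have "\<forall>t. ((\<lambda>t. f t + g t) has_real_derivative f' t + g' t) (at t)"
    "poly_bd Z (d + p) (N * d * K + N' * d * K) (\<lambda>t. f' t + g' t)"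
    by (auto intro: DERIV_add poly_bd.add)
  then show ?case
    by (intro exI[of _ "\<lambda>t. f' t + g' t"]) (simp add: algebra_simps)
next
  case (mult d N f e N' g)
  then obtain f' g' where
    f: "\<forall>t. (f has_real_derivative f' t) (at t)" "poly_bd Z (d + p) (N * d * K) f'" and
    g: "\<forall>t. (g has_real_derivative g' t) (at t)" "poly_bd Z (e + p) (N' * e * K) g'" by blast
  have "\<forall>t. ((\<lambda>t. f t * g t) has_real_derivative f' t * g t + g' t * f t) (at t)"
    using f(1) g(1) by (auto intro: DERIV_mult)
  \<comment> \<open>The two coefficient bounds add up to \<open>N * N' * (d + e) * K\<close>, as
    required for degree \<open>d + e\<close>.\<close>
  moreover have "poly_bd Z (d + e + p) (N * d * K * N' + N' * e * K * N)
      (\<lambda>t. f' t * g t + g' t * f t)"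
    using poly_bd.mult[OF f(2) mult.hyps(2)] poly_bd.mult[OF g(2) mult.hyps(1)]
    by (intro poly_bd.add) (simp_all add: add_ac)
  ultimately show ?case
    by (intro exI[of _ "\<lambda>t. f' t * g t + g' t * f t"]) (simp add: algebra_simps)
next
  case (weaken d N f e N')
  then obtain f' where f: "\<forall>t. (f has_real_derivative f' t) (at t)" 
    "poly_bd Z (d + p) (N * d * K) f'" by blast
  have "N * d * K \<le> N' * e * K"
    using weaken poly_bd_nonneg[OF weaken.hyps(1)] K
    by (intro mult_mono) auto
  with f weaken.hyps show ?case
    by (meson poly_bd.weaken add_le_mono1)
qed

text \<open>Hiding the bounds gives closure rules that can be applied purely by the shape of an
  expression.\<close>

definition polynomial_in :: "(real \<Rightarrow> real) set \<Rightarrow> (real \<Rightarrow> real) \<Rightarrow> bool" where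
  "polynomial_in Z f \<longleftrightarrow> (\<exists>d N. poly_bd Z d N f)"

lemma polynomial_in_gen: "z \<in> Z \<Longrightarrow> polynomial_in Z z"
  by (auto simp: polynomial_in_def intro: poly_bd.gen)

lemma polynomial_in_const: "polynomial_in Z (\<lambda>_. c)"
  by (auto simp: polynomial_in_def intro: poly_bd.const)

lemma polynomial_in_add:
  assumes "polynomial_in Z f" "polynomial_in Z g"
  shows "polynomial_in Z (\<lambda>t. f t + g t)"
proof -
  obtain d N e N' where "poly_bd Z d N f" "poly_bd Z e N' g"
    using assms by (auto simp: polynomial_in_def)
  then have "poly_bd Z (max d e) N f" "poly_bd Z (max d e) N' g"
    by (auto intro: poly_bd.weaken)
  then show ?thesis
    by (auto simp: polynomial_in_def intro: poly_bd.add)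
qed

lemma polynomial_in_mult:
  "polynomial_in Z f \<Longrightarrow> polynomial_in Z g \<Longrightarrow> polynomial_in Z (\<lambda>t. f t * g t)"
  by (auto simp: polynomial_in_def intro: poly_bd.mult)

lemma polynomial_in_diff:
  assumes "polynomial_in Z f" "polynomial_in Z g"
  shows "polynomial_in Z (\<lambda>t. f t - g t)"
  using polynomial_in_add[OF assms(1) polynomial_in_mult[OF polynomial_in_const[of Z "-1"] assms(2)]]
  by simp

lemma polynomial_in_sum:
  "(\<And>k. k \<in> I \<Longrightarrow> polynomial_in Z (f k)) \<Longrightarrow> polynomial_in Z (\<lambda>t. \<Sum>k\<in>I. f k t)"
  by (induction I rule: infinite_finite_induct)
    (auto intro: polynomial_in_const polynomial_in_add)

lemmas polynomial_in_intros =
  polynomial_in_const polynomial_in_add polynomial_in_mult polynomial_in_diff polynomial_in_sum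

section \<open>Factorial bounds and uniqueness for polynomial systems\<close>

locale polynomial_ode =
  fixes Z :: "(real \<Rightarrow> real) set"
  assumes fin: "finite Z"
    and ode: "z \<in> Z \<Longrightarrow> \<exists>z'. (\<forall>t. (z has_real_derivative z' t) (at t)) \<and> polynomial_in Z z'"
begin

text \<open>Sums over the finite set \<open>Z\<close> serve as common upper bounds in place of
  maxima. The form \<open>Suc p\<close> makes \<open>p\<close> the degree increase per
  differentiation.\<close>

lemma uniform_degree:
  obtains p K where "0 \<le> K"
    "\<forall>z\<in>Z. \<exists>z'. (\<forall>t. (z has_real_derivative z' t) (at t)) \<and> poly_bd Z (Suc p) K z'"
proof -
  have "\<forall>z\<in>Z. \<exists>z' d N. (\<forall>t. (z has_real_derivative z' t) (at t)) \<and> poly_bd Z d N z'"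
    using ode by (fastforce simp: polynomial_in_def)
  then obtain z' d N where
    *: "\<And>z. z \<in> Z \<Longrightarrow> (\<forall>t. (z has_real_derivative z' z t) (at t)) \<and> poly_bd Z (d z) (N z) (z' z)"
    by metis
  have N: "0 \<le> N z" if "z \<in> Z" for z
    using * that poly_bd_nonneg by blast
  show thesis
  proof
    show "0 \<le> sum N Z" using N by (rule sum_nonneg)
    show "\<forall>z\<in>Z. \<exists>z'. (\<forall>t. (z has_real_derivative z' t) (at t)) \<and>
        poly_bd Z (Suc (sum d Z)) (sum N Z) z'"
    proof
      fix z assume z: "z \<in> Z"
      have "poly_bd Z (Suc (sum d Z)) (sum N Z) (z' z)"
      proof (rule poly_bd.weaken)
        show "poly_bd Z (d z) (N z) (z' z)" using * z by blast
        show "d z \<le> Suc (sum d Z)" using member_le_sum[OF z _ fin, of d] by simp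
        show "N z \<le> sum N Z" using member_le_sum[OF z _ fin, of N] N by simp
      qed
      then show "\<exists>z'. (\<forall>t. (z has_real_derivative z' t) (at t)) \<and>
          poly_bd Z (Suc (sum d Z)) (sum N Z) z'"
        using * z by blast
    qed
  qed
qed

text \<open>Differentiation number \<open>n + 1\<close> multiplies the coefficient bound by
  \<open>(d + n * p) * K\<close>, which is at most \<open>(d + p) * K * (n + 1)\<close>. The factors
  \<open>n + 1\<close> accumulate to the factorial.\<close>

lemma poly_bd_higher_deriv:
  assumes "poly_bd Z d N f" "0 \<le> K"
    and Z: "\<forall>z\<in>Z. \<exists>z'. (\<forall>t. (z has_real_derivative z' t) (at t)) \<and> poly_bd Z (Suc p) K z'"
  shows "poly_bd Z (d + n * p) (N * (real (d + p) * K) ^ n * fact n) ((deriv ^^ n) f)"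
proof (induction n)
  case 0
  then show ?case using assms(1) by simp
next
  case (Suc n)
  let ?N = "N * (real (d + p) * K) ^ n * fact n"
  obtain g' where g': "\<forall>t. ((deriv ^^ n) f has_real_derivative g' t) (at t)"
    "poly_bd Z (d + n * p + p) (?N * (d + n * p) * K) g'"
    using poly_bd_has_derivative[OF Suc.IH assms(2) Z] by blast
  have "(deriv ^^ Suc n) f = g'"
    using g'(1) by (auto intro!: DERIV_imp_deriv)
  moreover have "?N * (d + n * p) * K \<le> N * (real (d + p) * K) ^ Suc n * fact (Suc n)"
  proof -
    have "d + n * p \<le> (d + p) * Suc n" by (simp add: algebra_simps)
    then have "real (d + n * p) \<le> real ((d + p) * Suc n)" by (simp only: of_nat_le_iff)
    then have "?N * real (d + n * p) * K \<le> ?N * real ((d + p) * Suc n) * K"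
      using poly_bd_nonneg[OF assms(1)] assms(2)
      by (intro mult_right_mono mult_left_mono) auto
    also have "\<dots> = N * (real (d + p) * K) ^ Suc n * fact (Suc n)"
      by (simp only: of_nat_mult fact_Suc power_Suc mult_ac)
    finally show ?thesis .
  qed
  ultimately show ?case
    using poly_bd.weaken[OF g'(2)] by (simp add: add_ac)
qed

text \<open>\<open>deriv\<close> is meaningful only for differentiable functions. Every iterate is
  again a polynomial in the generators, hence differentiable.\<close>

lemma higher_deriv_has_derivative:
  assumes "polynomial_in Z f"
  shows "((deriv ^^ n) f has_real_derivative (deriv ^^ Suc n) f t) (at t)"
proof -
  obtain d N where f: "poly_bd Z d N f"
    using assms by (auto simp: polynomial_in_def)
  obtain p K where K: "0 \<le> K"
    "\<forall>z\<in>Z. \<exists>z'. (\<forall>t. (z has_real_derivative z' t) (at t)) \<and> poly_bd Z (Suc p) K z'"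
    using uniform_degree .
  then obtain g' where "((deriv ^^ n) f has_real_derivative g' t) (at t)"
    using poly_bd_has_derivative[OF poly_bd_higher_deriv[OF f K] K] by blast
  then show ?thesis
    by (simp add: DERIV_imp_deriv)
qed

lemma locally_bounded:
  obtains M where "1 \<le> M" "\<And>z s. z \<in> Z \<Longrightarrow> \<bar>s - c\<bar> < 1 \<Longrightarrow> \<bar>z s\<bar> \<le> M"
proof -
  have "continuous_on (cball c 1) z" if "z \<in> Z" for z
    using ode[OF that] by (meson DERIV_isCont continuous_at_imp_continuous_on)
  then have "bounded (\<Union>z\<in>Z. z ` cball c 1)"
    using fin by (auto intro!: compact_imp_bounded compact_continuous_image)
  then obtain b where "\<forall>y\<in>(\<Union>z\<in>Z. z ` cball c 1). norm y \<le> b"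
    by (auto simp: bounded_iff)
  then have "\<bar>z s\<bar> \<le> b" if "z \<in> Z" "\<bar>s - c\<bar> < 1" for z s
    using that by (force simp: dist_real_def)
  then show thesis
    \<comment> \<open>The maximum with 1 supplies the lower bound on \<open>M\<close> that
      \<open>poly_bd_abs_le\<close> demands.\<close>
    by (intro that[of "max 1 b"]) (auto simp: le_max_iff_disj)
qed

text \<open>Although the degree grows with \<open>n\<close>, it does so linearly:
  \<open>M ^ (d + n * p)\<close> splits into a constant and \<open>(M ^ p) ^ n\<close>, which is
  absorbed into \<open>C ^ n\<close>.\<close>

lemma factorial_bounds:
  assumes "polynomial_in Z f"
  shows "\<exists>A C. 0 \<le> C \<and> (\<forall>n s. \<bar>s - c\<bar> < 1 \<longrightarrow> \<bar>(deriv ^^ n) f s\<bar> \<le> A * C ^ n * fact n)"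
proof -
  obtain d N where f: "poly_bd Z d N f"
    using assms by (auto simp: polynomial_in_def)
  obtain p K where K: "0 \<le> K"
    "\<forall>z\<in>Z. \<exists>z'. (\<forall>t. (z has_real_derivative z' t) (at t)) \<and> poly_bd Z (Suc p) K z'"
    using uniform_degree .
  obtain M where M: "1 \<le> M" "\<And>z s. z \<in> Z \<Longrightarrow> \<bar>s - c\<bar> < 1 \<Longrightarrow> \<bar>z s\<bar> \<le> M"
    using locally_bounded[of c] by metis
  have "\<bar>(deriv ^^ n) f s\<bar> \<le> (N * M ^ d) * (real (d + p) * K * M ^ p) ^ n * fact n"
    if "\<bar>s - c\<bar> < 1" for n s
  proof -
    have "\<bar>(deriv ^^ n) f s\<bar> \<le> N * (real (d + p) * K) ^ n * fact n * M ^ (d + n * p)"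
      using that M by (intro poly_bd_abs_le[OF poly_bd_higher_deriv[OF f K]]) auto
    also have "\<dots> = (N * M ^ d) * (real (d + p) * K * M ^ p) ^ n * fact n"
      by (simp add: power_add power_mult_distrib power_mult[symmetric] mult_ac)
    finally show ?thesis .
  qed
  moreover have "0 \<le> real (d + p) * K * M ^ p"
    using K(1) M(1) by simp
  ultimately show ?thesis by blast
qed

lemma eq_0_if_higher_derivs_0:
  assumes "polynomial_in Z f" "\<And>n. (deriv ^^ n) f t1 = 0"
  shows "f t = 0"
  using factorial_bounds_imp_eq_0[of "\<lambda>n. (deriv ^^ n) f" t1 t]
    higher_deriv_has_derivative[OF assms(1)] factorial_bounds[OF assms(1)] assms(2)
  by simp

lemma higher_deriv_diff:
  assumes "polynomial_in Z f" "polynomial_in Z g"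
  shows "(deriv ^^ n) (\<lambda>t. f t - g t) = (\<lambda>t. (deriv ^^ n) f t - (deriv ^^ n) g t)"
proof (induction n)
  case (Suc n)
  have "((\<lambda>t. (deriv ^^ n) f t - (deriv ^^ n) g t) has_real_derivative
      (deriv ^^ Suc n) f t - (deriv ^^ Suc n) g t) (at t)" for t
    using assms by (intro DERIV_diff higher_deriv_has_derivative)
  then show ?case
    by (auto simp: Suc.IH intro!: DERIV_imp_deriv)
qed simp

lemma eq_if_higher_derivs_eq:
  assumes "polynomial_in Z f" "polynomial_in Z g"
    and "\<And>n. (deriv ^^ n) f t1 = (deriv ^^ n) g t1"
  shows "f = g"
proof
  fix t
  show "f t = g t"
    using eq_0_if_higher_derivs_0[OF polynomial_in_diff[OF assms(1,2)], of t1 t] assms(3)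
    by (simp add: higher_deriv_diff[OF assms(1,2)])
qed

end

section \<open>The force equation as a polynomial system\<close>

definition inv_sq_dist :: "(real \<Rightarrow> real^'m^'m) \<Rightarrow> 'm::finite \<Rightarrow> 'm \<Rightarrow> real \<Rightarrow> real" where
  "inv_sq_dist X i k t = 1 / (norm (row i (X t) - row k (X t)))\<^sup>2"

text \<open>Velocities and inverse squared distances are adjoined to make the set closed under
  differentiation up to polynomials. Ranges over finite index types make it finite.\<close>

definition ode_generators ::
  "(real \<Rightarrow> real^'m^'m) \<Rightarrow> (real \<Rightarrow> real^'m^'m) \<Rightarrow> (real \<Rightarrow> real) set" where
  "ode_generators X Y = range (\<lambda>(i, j) t. X t $ i $ j) \<union> range (\<lambda>(i, j) t. Y t $ i $ j)
     \<union> range (\<lambda>(i, k). inv_sq_dist X i k)"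

lemma ode_generators_memI:
  "(\<lambda>t. X t $ i $ j) \<in> ode_generators X Y"
  "(\<lambda>t. Y t $ i $ j) \<in> ode_generators X Y"
  "inv_sq_dist X i k \<in> ode_generators X Y"
  by (auto simp: ode_generators_def image_iff)

lemma has_vector_derivative_entry:
  fixes X :: "real \<Rightarrow> real^'n^'m"
  assumes "(X has_vector_derivative X') (at t)"
  shows "((\<lambda>t. X t $ i $ j) has_real_derivative X' $ i $ j) (at t)"
proof -
  have "bounded_linear (\<lambda>A::real^'n^'m. A $ i $ j)"
    using bounded_linear_compose[OF bounded_linear_vec_nth bounded_linear_vec_nth] .
  from bounded_linear.has_vector_derivative[OF this assms]
  show ?thesis
    by (simp add: has_real_derivative_iff_has_vector_derivative)
qed

lemma norm_row_diff_sq: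
  "(norm (row i A - row k A))\<^sup>2 = (\<Sum>j\<in>UNIV. (A $ i $ j - A $ k $ j)\<^sup>2)" for A :: "real^'n^'m"
  unfolding power2_norm_eq_inner by (simp add: inner_vec_def row_def power2_eq_square)

text \<open>With \<open>q\<close> the squared distance, \<open>(1 / q)' = - q' / q^2\<close>.
  Writing \<open>1 / q\<close> as a generator makes this polynomial; distinctness of the rows gives
  \<open>q t\<close> nonzero.\<close>

lemma has_derivative_inv_sq_dist:
  assumes "X t \<in> distinct_rows" "(X has_vector_derivative Y t) (at t)"
  shows "(inv_sq_dist X i k has_real_derivative
     (-2) * (inv_sq_dist X i k t * inv_sq_dist X i k t) *
       (\<Sum>j\<in>UNIV. (X t $ i $ j - X t $ k $ j) * (Y t $ i $ j - Y t $ k $ j))) (at t)"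
proof (cases "i = k")
  \<comment> \<open>Here \<open>1 / 0 = 0\<close> makes the generator constantly 0, and the formula
    gives 0 too.\<close>
  case True
  then have "inv_sq_dist X i k = (\<lambda>_. 0)"
    by (simp add: inv_sq_dist_def fun_eq_iff)
  then show ?thesis by simp
next
  case False
  define q where "q = (\<lambda>t. \<Sum>j\<in>UNIV. (X t $ i $ j - X t $ k $ j)\<^sup>2)"
  define s where "s = (\<Sum>j\<in>UNIV. (X t $ i $ j - X t $ k $ j) * (Y t $ i $ j - Y t $ k $ j))"
  have inv: "inv_sq_dist X i k = (\<lambda>t. 1 / q t)"
    by (simp add: inv_sq_dist_def norm_row_diff_sq q_def fun_eq_iff)
  have "q t \<noteq> 0"
    using assms(1) False by (simp add: q_def norm_row_diff_sq[symmetric] distinct_rows_def)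
  have "(q has_real_derivative
      (\<Sum>j\<in>UNIV. 2 * (X t $ i $ j - X t $ k $ j) * (Y t $ i $ j - Y t $ k $ j))) (at t)"
    unfolding q_def
    by (auto intro!: derivative_eq_intros has_vector_derivative_entry[OF assms(2)] sum.cong)
  then have "(q has_real_derivative 2 * s) (at t)"
    by (simp only: s_def sum_distrib_left mult.assoc)
  then have "((\<lambda>t. 1 / q t) has_real_derivative (-2) * (1 / q t * (1 / q t)) * s) (at t)"
    using \<open>q t \<noteq> 0\<close> by (auto intro!: derivative_eq_intros simp: field_simps)
  then show ?thesis
    by (simp add: inv s_def)
qed

lemma global_solution_polynomial_ode:
  assumes "global_solution H t0 B V X Y"
  shows "polynomial_ode (ode_generators X Y)"
proof
  let ?Z = "ode_generators X Y"
  show "finite ?Z"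
    by (simp add: ode_generators_def)
  have dist: "X t \<in> distinct_rows"
    and X: "(X has_vector_derivative Y t) (at t)"
    and Y: "(Y has_vector_derivative force H (X t)) (at t)" for t
    using assms by (auto simp: global_solution_def)
  note gens = ode_generators_memI[THEN polynomial_in_gen]
  fix z assume "z \<in> ?Z"
  then consider (x) i j where "z = (\<lambda>t. X t $ i $ j)" | (y) i j where "z = (\<lambda>t. Y t $ i $ j)"
    | (u) i k where "z = inv_sq_dist X i k"
    by (auto simp: ode_generators_def)
  then show "\<exists>z'. (\<forall>t. (z has_real_derivative z' t) (at t)) \<and> polynomial_in ?Z z'"
  proof cases
    case x
    show ?thesis
      unfolding x by (intro exI[of _ "\<lambda>t. Y t $ i $ j"] conjI allI has_vector_derivative_entry X gens)
  next
    case y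
    \<comment> \<open>The only non-polynomial factor of the force is the reciprocal, which is itself
      a generator.\<close>
    have "(\<lambda>t. force H (X t) $ i $ j) =
        (\<lambda>t. \<Sum>k\<in>UNIV - {i}. (X t $ i $ j - X t $ k $ j) * (inv_sq_dist X i k t - H $ i $ k))"
      by (simp add: force_def inv_sq_dist_def)
    moreover have "polynomial_in ?Z (\<lambda>t.
        \<Sum>k\<in>UNIV - {i}. (X t $ i $ j - X t $ k $ j) * (inv_sq_dist X i k t - H $ i $ k))"
      by (intro polynomial_in_intros gens)
    ultimately have "polynomial_in ?Z (\<lambda>t. force H (X t) $ i $ j)" by simp
    then show ?thesis
      unfolding y
      by (intro exI[of _ "\<lambda>t. force H (X t) $ i $ j"] conjI allI has_vector_derivative_entry Y)
  next
    case u
    have "polynomial_in ?Z (\<lambda>t. (-2) * (inv_sq_dist X i k t * inv_sq_dist X i k t) *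
       (\<Sum>j\<in>UNIV. (X t $ i $ j - X t $ k $ j) * (Y t $ i $ j - Y t $ k $ j)))"
      by (intro polynomial_in_intros gens)
    moreover have "(z has_real_derivative (-2) * (inv_sq_dist X i k t * inv_sq_dist X i k t) *
       (\<Sum>j\<in>UNIV. (X t $ i $ j - X t $ k $ j) * (Y t $ i $ j - Y t $ k $ j))) (at t)" for t
      unfolding u by (rule has_derivative_inv_sq_dist[OF dist X])
    ultimately show ?thesis
      by (intro exI conjI allI)
  qed
qed

theorem theorem4:
  fixes E :: "'m::finite set set"
    and H B V :: "real^'m^'m"
    and t0 :: real
    and X Y :: "real \<Rightarrow> real^'m^'m"
  assumes "simple_graph E" and "H = adjacency_matrix E"
    and "B \<in> distinct_rows"
    and "global_solution H t0 B V X Y"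
  shows "\<forall>t1 i j r s.
    (\<lambda>n. taylor_coeff X i j t1 n) = (\<lambda>n. taylor_coeff X r s t1 n) \<longleftrightarrow>
    (\<lambda>t. X t $ i $ j) = (\<lambda>t. X t $ r $ s)"
proof (intro allI iffI)
  fix t1 i j r s
  interpret polynomial_ode "ode_generators X Y"
    using assms(4) by (rule global_solution_polynomial_ode)
  {
    assume "(\<lambda>n. taylor_coeff X i j t1 n) = (\<lambda>n. taylor_coeff X r s t1 n)"
    \<comment> \<open>The nonzero factor \<open>fact n\<close> cancels.\<close>
    then have "(deriv ^^ n) (\<lambda>t. X t $ i $ j) t1 = (deriv ^^ n) (\<lambda>t. X t $ r $ s) t1" for n
      by (simp add: taylor_coeff_def fun_eq_iff)
    then show "(\<lambda>t. X t $ i $ j) = (\<lambda>t. X t $ r $ s)"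
      by (rule eq_if_higher_derivs_eq[OF ode_generators_memI(1,1)[THEN polynomial_in_gen]])
  }
  show "(\<lambda>n. taylor_coeff X i j t1 n) = (\<lambda>n. taylor_coeff X r s t1 n)"
    if "(\<lambda>t. X t $ i $ j) = (\<lambda>t. X t $ r $ s)"
    by (simp add: taylor_coeff_def that)
qed

end
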